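(* Let $q>2$ be an odd integer. Then $$\liminf_{x\to\infty}\frac{\#\{n\le x: 2\mid f_{2,q}(n)\}}{x}\ge\frac{1}{2q}-\frac{1}{2q^2},$$ and, for $q\ge5$, $$\#\{n\le x: 2\nmid f_{2,q}(n)\}\gg_q x^{\frac{\log\frac{q-1}{2}}{\log q}}$$ for all sufficiently large $x$ (with implied constant depending only on $q$), where $n$ ranges over positive integers. Moreover, $f_{2,3}(n)$ is odd for infinitely many $n$.
   Context: $\mathbb{N}$ denotes the set of nonnegative integers. For an odd integer $q>2$, $f_{2,q}(n)$ denotes the number of different expressions of the positive integer $n$ as a sum of distinct terms taken from $\{2^{\alpha}q^{\beta}:\alpha,\beta\in\mathbb{N}\}$ (i.e. the number of finite subsets of this set whose elements sum to $n$). *)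

theory Defs
  imports "HOL-Analysis.Analysis"
begin

definition power_products :: "nat \<Rightarrow> nat \<Rightarrow> nat set" where
  "power_products p q = {p ^ \<alpha> * q ^ \<beta> | \<alpha> \<beta>. True}"

text \<open>For \<open>p, q \<ge> 2\<close> every admissible \<open>S\<close> lies in \<open>{1..n}\<close>, so the counted family is finite
  and the cardinality is the true number of representations.\<close>

definition num_reps :: "nat \<Rightarrow> nat \<Rightarrow> nat \<Rightarrow> nat" where
  "num_reps p q n = card {S. finite S \<and> S \<subseteq> power_products p q \<and> \<Sum>S = n}"

end

theory Submission
  imports Defs "HOL-Library.Nat_Bijection"
begin

text \<open>
  The powers of two contained in a representation \<open>S\<close> of \<open>n\<close> are determined by their sum, and the
  rest of \<open>S\<close> is \<open>q\<close> times a representation of some \<open>m \<le> n div q\<close>, which may be chosen freely.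
  Hence \<open>f n = g (n div q)\<close> with \<open>g m = f 0 + \<dots> + f m\<close>, and so
  \<open>g (m + 1) = g m + g ((m + 1) div q)\<close>.
  If \<open>g k\<close> is odd, the parities of \<open>g (q * k), \<dots>, g (q * k + q - 1)\<close> therefore alternate, and at
  least \<open>h = (q - 1) / 2\<close> of these values are odd and at least \<open>h\<close> are even. The odd values thus
  multiply by \<open>h\<close> each time the range multiplies by \<open>q\<close>. For the even values, either at least
  \<open>h * N / q\<close> of the \<open>m < N\<close> have \<open>g m\<close> even, or enough of them have \<open>g m\<close> odd to produce that many
  even values below \<open>q * N\<close>.
\<close>

section \<open>Splitting a representation into powers of two and multiples of q\<close>

definition reps :: "nat \<Rightarrow> nat \<Rightarrow> nat set set" where
  "reps q n = {S. finite S \<and> S \<subseteq> power_products 2 q \<and> \<Sum>S = n}"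

lemma num_reps_eq_card_reps: "num_reps 2 q n = card (reps q n)"
  by (simp add: num_reps_def reps_def)

lemma finite_reps: "finite (reps q n)"
proof (rule finite_subset)
  show "reps q n \<subseteq> Pow {..n}"
    unfolding reps_def using member_le_sum[of _ _ "\<lambda>x::nat. x"] by auto
qed simp

lemma power_of_two_in_power_products: "2 ^ a \<in> power_products 2 q"
  unfolding power_products_def by (rule CollectI, rule exI[of _ a], rule exI[of _ 0]) simp

lemma times_in_power_products: "t \<in> power_products 2 q \<Longrightarrow> q * t \<in> power_products 2 q"
  unfolding power_products_def
  by (clarsimp, rename_tac a b, rule_tac x=a in exI, rule_tac x="Suc b" in exI) simp

lemma power_products_cases:
  assumes "x \<in> power_products 2 q"
  obtains a where "x = 2 ^ a" | t where "x = q * t" "t \<in> power_products 2 q"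
proof -
  from assms obtain a b where x: "x = 2 ^ a * q ^ b"
    unfolding power_products_def by auto
  show thesis
  proof (cases b)
    case 0
    with x that(1) show thesis by simp
  next
    case (Suc c)
    with x have "x = q * (2 ^ a * q ^ c)" by simp
    moreover have "2 ^ a * q ^ c \<in> power_products 2 q"
      unfolding power_products_def by auto
    ultimately show thesis using that(2) by blast
  qed
qed

lemma odd_not_dvd_power_of_two:
  fixes q :: nat
  assumes "odd q" "q > 1"
  shows "\<not> q dvd 2 ^ a"
proof
  assume "q dvd 2 ^ a"
  moreover have "coprime q (2 ^ a)" using assms by simp
  ultimately have "q = 1" by (metis coprime_common_divisor_nat dvd_refl One_nat_def)
  with assms show False by simp
qed

text \<open>No power of two is a multiple of \<open>q\<close>, so a representation splits uniquely
  into its powers of two and its multiples of \<open>q\<close>; the map keeps the latter, divided by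
  \<open>q\<close>. Its inverse multiplies \<open>T\<close> by \<open>q\<close> and fills the gap
  \<open>n - q * \<Sum>T\<close> with the binary expansion of that number.\<close>

lemma bij_betw_reps:
  assumes q: "odd q" "q > 1"
  shows "bij_betw (\<lambda>S. {t. q * t \<in> S}) (reps q n) (\<Union>m\<le>n div q. reps q m)"
proof (rule bij_betw_byWitness[where
      f' = "\<lambda>T. (^) 2 ` set_decode (n - q * \<Sum>T) \<union> (*) q ` T"])
  note nd = odd_not_dvd_power_of_two[OF q]
  have inj: "inj_on ((*) q) X" for X :: "nat set"
    using q by (auto intro: inj_onI)
  have inj2: "inj_on ((^) (2::nat)) X" for X
    by (auto intro: inj_onI)
  have disj: "(^) 2 ` X \<inter> (*) q ` Y = {}" for X Y
    using nd by (metis (no_types, lifting) disjoint_iff dvd_triv_left imageE)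
  have split: "finite {i. 2 ^ i \<in> S} \<and> finite {t. q * t \<in> S} \<and>
      {t. q * t \<in> S} \<subseteq> power_products 2 q \<and>
      S = (^) 2 ` {i. 2 ^ i \<in> S} \<union> (*) q ` {t. q * t \<in> S} \<and>
      n = set_encode {i. 2 ^ i \<in> S} + q * \<Sum>{t. q * t \<in> S}"
    if "S \<in> reps q n" for S
  proof -
    from that have S: "finite S" "S \<subseteq> power_products 2 q" "\<Sum>S = n"
      by (auto simp: reps_def)
    let ?A = "{i. 2 ^ i \<in> S}" and ?T = "{t. q * t \<in> S}"
    have fA: "finite ?A"
      using finite_vimageI[OF S(1), of "(^) (2::nat)"] inj2 by (simp add: vimage_def)
    have fT: "finite ?T"
      using finite_vimageI[OF S(1), of "(*) q"] inj by (simp add: vimage_def)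
    have T: "?T \<subseteq> power_products 2 q"
    proof safe
      fix t assume "q * t \<in> S"
      with S have "q * t \<in> power_products 2 q" by auto
      then show "t \<in> power_products 2 q"
      proof (cases rule: power_products_cases)
        case (1 a)
        then show ?thesis using nd[of a] by (metis dvd_triv_left)
      next
        case (2 t')
        then show ?thesis using q by auto
      qed
    qed
    have "x \<in> (^) 2 ` ?A \<union> (*) q ` ?T" if "x \<in> S" for x
    proof -
      have "x \<in> power_products 2 q" using S(2) that by blast
      then show ?thesis using that by (cases rule: power_products_cases) auto
    qed
    then have eq: "S = (^) 2 ` ?A \<union> (*) q ` ?T" by blast
    have "n = \<Sum>((^) 2 ` ?A \<union> (*) q ` ?T)" using S(3) eq by simp
    also have "\<dots> = \<Sum>((^) 2 ` ?A) + \<Sum>((*) q ` ?T)"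
      using fA fT disj by (intro sum.union_disjoint) auto
    also have "\<dots> = set_encode ?A + q * \<Sum>?T"
      by (simp add: sum.reindex[OF inj2] sum.reindex[OF inj] set_encode_def sum_distrib_left o_def)
    finally show ?thesis using fA fT T eq by blast
  qed
  show "\<forall>S\<in>reps q n. (^) 2 ` set_decode (n - q * \<Sum>{t. q * t \<in> S}) \<union> (*) q ` {t. q * t \<in> S} = S"
  proof
    fix S assume "S \<in> reps q n"
    note s = split[OF this]
    \<comment> \<open>The natural subtraction is exact here: what remains is the sum of the powers
      of two in \<open>S\<close>, from which \<open>set_decode\<close> recovers their
      exponents.\<close>
    then have "n - q * \<Sum>{t. q * t \<in> S} = set_encode {i. 2 ^ i \<in> S}" by linarith
    then show "(^) 2 ` set_decode (n - q * \<Sum>{t. q * t \<in> S}) \<union> (*) q ` {t. q * t \<in> S} = S"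
      using s by (simp only: set_encode_inverse)
  qed
  show "\<forall>T\<in>\<Union>m\<le>n div q. reps q m.
      {t. q * t \<in> (^) 2 ` set_decode (n - q * \<Sum>T) \<union> (*) q ` T} = T"
  proof
    fix T assume "T \<in> (\<Union>m\<le>n div q. reps q m)"
    have "q * t \<noteq> 2 ^ a" for t a using nd[of a] by (metis dvd_triv_left)
    then show "{t. q * t \<in> (^) 2 ` set_decode (n - q * \<Sum>T) \<union> (*) q ` T} = T"
      using q by auto
  qed
  show "(\<lambda>S. {t. q * t \<in> S}) ` reps q n \<subseteq> (\<Union>m\<le>n div q. reps q m)"
  proof safe
    fix S assume "S \<in> reps q n"
    note s = split[OF this]
    then have "\<Sum>{t. q * t \<in> S} * q \<le> n" by (simp add: mult.commute)
    then have "\<Sum>{t. q * t \<in> S} \<le> n div q" using q by (simp add: less_eq_div_iff_mult_less_eq)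
    then show "{t. q * t \<in> S} \<in> (\<Union>m\<le>n div q. reps q m)"
      using s by (auto simp: reps_def)
  qed
  show "(\<lambda>T. (^) 2 ` set_decode (n - q * \<Sum>T) \<union> (*) q ` T) ` (\<Union>m\<le>n div q. reps q m)
      \<subseteq> reps q n"
  proof safe
    fix T m assume "m \<le> n div q" "T \<in> reps q m"
    then have T: "finite T" "T \<subseteq> power_products 2 q" "\<Sum>T \<le> n div q"
      by (auto simp: reps_def)
    then have le: "q * \<Sum>T \<le> n"
      using q by (simp add: less_eq_div_iff_mult_less_eq mult.commute)
    let ?A = "set_decode (n - q * \<Sum>T)"
    have "\<Sum>((^) 2 ` ?A \<union> (*) q ` T) = \<Sum>((^) 2 ` ?A) + \<Sum>((*) q ` T)"
      using T disj by (intro sum.union_disjoint) auto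
    also have "\<dots> = set_encode ?A + q * \<Sum>T"
      by (simp add: sum.reindex[OF inj2] sum.reindex[OF inj] set_encode_def sum_distrib_left o_def)
    also have "\<dots> = n" using le by simp
    finally show "(^) 2 ` ?A \<union> (*) q ` T \<in> reps q n"
      using T power_of_two_in_power_products times_in_power_products by (auto simp: reps_def)
  qed
qed

lemma num_reps_eq_sum:
  assumes "odd q" "q > 1"
  shows "num_reps 2 q n = (\<Sum>m\<le>n div q. num_reps 2 q m)"
proof -
  have "num_reps 2 q n = card (\<Union>m\<le>n div q. reps q m)"
    using bij_betw_same_card[OF bij_betw_reps[OF assms]] by (simp add: num_reps_eq_card_reps)
  also have "\<dots> = (\<Sum>m\<le>n div q. card (reps q m))"
    \<comment> \<open>The families \<open>reps q m\<close> are disjoint for different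
      \<open>m\<close>, since the sum of a member determines \<open>m\<close>.\<close>
    by (intro card_UN_disjoint) (auto simp: finite_reps, auto simp: reps_def)
  finally show ?thesis by (simp add: num_reps_eq_card_reps)
qed

text \<open>All elements of \<open>power_products 2 q\<close> are positive when
  \<open>q > 0\<close>, so only the empty set has sum 0.\<close>

lemma num_reps_0: "q > 0 \<Longrightarrow> num_reps 2 q 0 = 1"
proof -
  assume "q > 0"
  then have "reps q 0 = {{}}"
    by (fastforce simp: reps_def power_products_def)
  then show ?thesis by (simp add: num_reps_eq_card_reps)
qed

section \<open>Parities of the partial sums\<close>

definition sum_reps :: "nat \<Rightarrow> nat \<Rightarrow> nat" where
  "sum_reps q m = (\<Sum>i\<le>m. num_reps 2 q i)"

text \<open>The parity is a parameter, with \<open>True\<close> for odd, so that one growth estimate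
  serves both parities.\<close>

definition parity_count :: "nat \<Rightarrow> bool \<Rightarrow> nat \<Rightarrow> nat" where
  "parity_count q b N = card {m. m < N \<and> odd (sum_reps q m) = b}"

lemma num_reps_eq_sum_reps:
  "odd q \<Longrightarrow> q > 1 \<Longrightarrow> num_reps 2 q n = sum_reps q (n div q)"
  using num_reps_eq_sum by (simp add: sum_reps_def)

lemma sum_reps_0: "q > 0 \<Longrightarrow> sum_reps q 0 = 1"
  by (simp add: sum_reps_def num_reps_0)

lemma sum_reps_Suc:
  "odd q \<Longrightarrow> q > 1 \<Longrightarrow> sum_reps q (Suc m) = sum_reps q m + sum_reps q (Suc m div q)"
  using num_reps_eq_sum_reps[of q "Suc m"] by (simp add: sum_reps_def)

lemma sum_reps_Suc_in_block:
  assumes "odd q" "q > 1" "Suc r < q"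
  shows "sum_reps q (Suc (q * k + r)) = sum_reps q (q * k + r) + sum_reps q k"
proof -
  have "Suc (q * k + r) div q = (Suc r + q * k) div q" by (simp add: add.commute)
  also have "\<dots> = k" using assms by (simp only: div_mult_self2) simp
  finally have "Suc (q * k + r) div q = k" .
  then show ?thesis using sum_reps_Suc[OF assms(1,2), of "q * k + r"] by simp
qed

lemma parity_count_add: "parity_count q True N + parity_count q False N = N"
proof -
  have "card ({m. m < N \<and> odd (sum_reps q m) = True} \<union> {m. m < N \<and> odd (sum_reps q m) = False})
     = parity_count q True N + parity_count q False N"
    unfolding parity_count_def by (rule card_Un_disjoint) auto
  moreover have "{m. m < N \<and> odd (sum_reps q m) = True} \<union> {m. m < N \<and> odd (sum_reps q m) = False}
     = {..<N}" by auto
  ultimately show ?thesis by simp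
qed

lemma parity_count_mono: "M \<le> N \<Longrightarrow> parity_count q b M \<le> parity_count q b N"
  unfolding parity_count_def by (rule card_mono) auto

text \<open>If \<open>sum_reps q k\<close> is odd, then for each \<open>j < (q - 1) div 2\<close>
  the values of \<open>sum_reps q\<close> at \<open>q * k + 2 * j\<close> and its successor differ
  in parity, so exactly one of them has parity \<open>b\<close>. Different pairs
  \<open>(k, j)\<close> give different arguments.\<close>

lemma parity_count_times:
  assumes q: "odd q" "q > 1"
  shows "(q - 1) div 2 * parity_count q True N \<le> parity_count q b (q * N)"
proof -
  let ?h = "(q - 1) div 2"
  let ?K = "{k. k < N \<and> odd (sum_reps q k) = True}"
  \<comment> \<open>\<open>r k j\<close> is the offset, \<open>2 * j\<close> or
    \<open>2 * j + 1\<close>, at which the required parity occurs. Both candidates are below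
    \<open>q\<close>, and halving recovers \<open>j\<close>, which yields injectivity.\<close>
  define r where "r k j = (if odd (sum_reps q (q * k + 2 * j)) = b then 2 * j else Suc (2 * j))"
    for k j
  define \<phi> where "\<phi> = (\<lambda>(k, j). q * k + r k j)"
  have r: "r k j < q" "r k j div 2 = j" if "j < ?h" for k j
    using that q by (auto simp: r_def)
  have div: "\<phi> (k, j) div q = k" "\<phi> (k, j) mod q = r k j" if "j < ?h" for k j
    using r(1)[OF that, of k] q by (simp_all add: \<phi>_def)
  have "card (?K \<times> {..<?h}) \<le> card {m. m < q * N \<and> odd (sum_reps q m) = b}"
  proof (rule card_inj_on_le)
    show "inj_on \<phi> (?K \<times> {..<?h})"
    proof (rule inj_onI, clarify)
      fix k j k' j' assume *: "j < ?h" "j' < ?h" "\<phi> (k, j) = \<phi> (k', j')"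
      then have "k = k'" using div(1) by metis
      moreover have "r k j = r k' j'" using * div(2) by metis
      then have "j = j'" using r(2) * by metis
      ultimately show "k = k' \<and> j = j'" by simp
    qed
    show "\<phi> ` (?K \<times> {..<?h}) \<subseteq> {m. m < q * N \<and> odd (sum_reps q m) = b}"
    proof clarify
      fix k j assume *: "k < N" "odd (sum_reps q k) = True" "j < ?h"
      have "\<phi> (k, j) div q < N" using div(1) * by simp
      then have "\<phi> (k, j) < q * N" using q by (simp add: div_less_iff_less_mult mult.commute)
      moreover have "sum_reps q (Suc (q * k + 2 * j)) = sum_reps q (q * k + 2 * j) + sum_reps q k"
        using * q by (intro sum_reps_Suc_in_block) auto
      then have "odd (sum_reps q (\<phi> (k, j))) = b" using * by (auto simp: \<phi>_def r_def)
      ultimately show "\<phi> (k, j) < q * N \<and> odd (sum_reps q (\<phi> (k, j))) = b" by simp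
    qed
  qed simp
  then show ?thesis by (simp add: parity_count_def card_cartesian_product mult.commute)
qed

lemma parity_count_True_power:
  assumes "odd q" "q > 1"
  shows "((q - 1) div 2) ^ k \<le> parity_count q True (q ^ k)"
proof (induction k)
  case 0
  have "{m. m < (1::nat) \<and> odd (sum_reps q m) = True} = {0}"
    using assms by (auto simp: sum_reps_0)
  then show ?case by (simp add: parity_count_def)
next
  case (Suc k)
  then have "(q - 1) div 2 * ((q - 1) div 2) ^ k \<le> (q - 1) div 2 * parity_count q True (q ^ k)"
    by simp
  also have "\<dots> \<le> parity_count q True (q * q ^ k)" by (rule parity_count_times[OF assms])
  finally show ?case by simp
qed

lemma parity_count_False_times:
  assumes q: "odd q" "q > 1"
  shows "(q - 1) div 2 * N \<le> q * parity_count q False (q * N)"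
proof (cases "(q - 1) div 2 * N \<le> q * parity_count q False N")
  case True
  also have "q * parity_count q False N \<le> q * parity_count q False (q * N)"
    using q by (intro mult_le_mono parity_count_mono) auto
  finally show ?thesis .
next
  case False
  let ?h = "(q - 1) div 2" and ?e = "parity_count q False N"
  have "?h * parity_count q True N \<le> parity_count q False (q * N)"
    by (rule parity_count_times[OF q])
  then have "q * (?h * parity_count q True N) \<le> q * parity_count q False (q * N)"
    by (rule mult_le_mono2)
  \<comment> \<open>In this case \<open>q * ?e < ?h * N\<close>, so \<open>q\<close> times the
    number of odd values exceeds \<open>(q - ?h) * N\<close>, which is at least
    \<open>N\<close>.\<close>
  moreover have "N \<le> q * parity_count q True N"
  proof -
    have "q * N = q * parity_count q True N + q * ?e"
      using parity_count_add[of q N] by (metis distrib_left)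
    moreover have "?h + 1 \<le> q" using q by presburger
    then have "(?h + 1) * N \<le> q * N" by (rule mult_le_mono1)
    then have "?h * N + N \<le> q * N" by (simp only: add_mult_distrib mult_1)
    ultimately show ?thesis using False by linarith
  qed
  then have "?h * N \<le> ?h * (q * parity_count q True N)" by (rule mult_le_mono2)
  ultimately show ?thesis by (simp only: mult.left_commute[of q ?h])
qed

section \<open>Counting positive integers up to x\<close>

lemma finite_bounded_nats: "finite {n :: nat. 0 < n \<and> real n \<le> x \<and> P n}"
proof (rule finite_subset)
  show "{n :: nat. 0 < n \<and> real n \<le> x \<and> P n} \<subseteq> {..nat \<lfloor>x\<rfloor>}"
    by (auto simp: le_nat_floor)
qed simp

text \<open>Each \<open>m < q * N\<close> with \<open>sum_reps q m\<close> even accounts for the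
  whole block of \<open>q\<close> integers with quotient \<open>m\<close>, all below
  \<open>q * q * N\<close>. This cancels the factor \<open>q\<close> on the right of
  \<open>parity_count_False_times\<close>.\<close>

lemma card_even_num_reps_ge:
  assumes q: "odd q" "q > 1" and x: "real (q * q * N) \<le> x"
  shows "(q - 1) div 2 * N \<le> card {n. 0 < n \<and> real n \<le> x \<and> even (num_reps 2 q n)}"
proof -
  let ?M = "{m. m < q * N \<and> odd (sum_reps q m) = False}"
  let ?B = "{n. 0 < n \<and> real n \<le> x \<and> even (num_reps 2 q n)}"
  have "card (?M \<times> {..<q}) \<le> card ?B"
  proof (rule card_inj_on_le[where f = "\<lambda>(m, r). q * m + r"])
    show "inj_on (\<lambda>(m, r). q * m + r) (?M \<times> {..<q})"
    proof (rule inj_onI, clarify)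
      fix m r m' r' assume *: "r < q" "r' < q" "q * m + r = q * m' + r'"
      have "(q * m + r) div q = m" "(q * m' + r') div q = m'" using *(1,2) by simp_all
      then have "m = m'" using *(3) by metis
      then show "m = m' \<and> r = r'" using *(3) by simp
    qed
    show "(\<lambda>(m, r). q * m + r) ` (?M \<times> {..<q}) \<subseteq> ?B"
    proof clarify
      fix m r assume *: "m < q * N" "odd (sum_reps q m) = False" "r < q"
      let ?n = "q * m + r"
      have "?n < q * Suc m" using * by simp
      also have "\<dots> \<le> q * (q * N)" using * by (intro mult_le_mono) auto
      finally have "real ?n \<le> real (q * q * N)" by (simp add: mult.assoc del: of_nat_mult of_nat_add)
      with x have "real ?n \<le> x" by linarith
      moreover have ev: "even (num_reps 2 q ?n)" using * q by (simp add: num_reps_eq_sum_reps)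
      \<comment> \<open>Zero is not among these integers because \<open>num_reps 2 q 0 = 1\<close>
        is odd.\<close>
      moreover have "?n \<noteq> 0" using ev num_reps_0[of q] q by (metis odd_one order.strict_trans zero_less_one)
      ultimately show "0 < ?n \<and> real ?n \<le> x \<and> even (num_reps 2 q ?n)" by simp
    qed
  qed (rule finite_bounded_nats)
  then have "q * parity_count q False (q * N) \<le> card ?B"
    by (simp add: parity_count_def card_cartesian_product mult.commute)
  then show ?thesis using parity_count_False_times[OF q, of N] by linarith
qed

text \<open>One integer per block suffices, as only the order of growth matters. The offset 1 in
  \<open>q * m + 1\<close> keeps it positive even for \<open>m = 0\<close>.\<close>

lemma card_odd_num_reps_ge:
  assumes q: "odd q" "q > 1" and x: "real (q * N) \<le> x"
  shows "parity_count q True N \<le> card {n. 0 < n \<and> real n \<le> x \<and> odd (num_reps 2 q n)}"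
  unfolding parity_count_def
proof (rule card_inj_on_le[where f = "\<lambda>m. q * m + 1"])
  show "inj_on (\<lambda>m. q * m + 1) {m. m < N \<and> odd (sum_reps q m) = True}"
    using q by (auto intro: inj_onI)
  show "(\<lambda>m. q * m + 1) ` {m. m < N \<and> odd (sum_reps q m) = True}
      \<subseteq> {n. 0 < n \<and> real n \<le> x \<and> odd (num_reps 2 q n)}"
  proof clarify
    fix m assume *: "m < N" "odd (sum_reps q m) = True"
    have "q * m + 1 \<le> q * Suc m" using q by simp
    also have "\<dots> \<le> q * N" using * by (intro mult_le_mono) auto
    finally have "real (q * m + 1) \<le> x" using x by (simp only: of_nat_le_iff[symmetric, where 'a=real])
    moreover have "(q * m + 1) div q = m" using q by (subst div_mult_self4) auto
    then have "odd (num_reps 2 q (q * m + 1))" using * q num_reps_eq_sum_reps by metis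
    ultimately show "0 < q * m + 1 \<and> real (q * m + 1) \<le> x \<and> odd (num_reps 2 q (q * m + 1))" by simp
  qed
qed (rule finite_bounded_nats)

section \<open>Asymptotic estimates\<close>

lemma Liminf_even_num_reps_ge:
  fixes q :: nat
  assumes q: "odd q" "q > 1"
  shows "ereal (1 / (2 * real q) - 1 / (2 * (real q)\<^sup>2)) \<le> Liminf at_top (\<lambda>x :: real.
            ereal (real (card {n :: nat. 0 < n \<and> real n \<le> x \<and> even (num_reps 2 q n)}) / x))"
proof -
  define h where "h = (real q - 1) / 2"
  have h: "real ((q - 1) div 2) = h" using q by (auto simp: h_def elim!: oddE)
  have h0: "h \<ge> 0" using q by (simp add: h_def)
  let ?L = "1 / (2 * real q) - 1 / (2 * (real q)\<^sup>2)"
  \<comment> \<open>The claimed density is \<open>h\<close> values per \<open>q * q\<close>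
    integers; rounding \<open>x / (real q)\<^sup>2\<close> down to \<open>N\<close> costs at most
    \<open>h\<close>, which vanishes after division by \<open>x\<close>.\<close>
  have L: "?L = h / (real q)\<^sup>2" using q by (simp add: h_def field_simps power2_eq_square)
  have "((\<lambda>x. h / x) \<longlongrightarrow> 0) at_top"
    by (rule real_tendsto_divide_at_top[OF tendsto_const filterlim_ident])
  then have "((\<lambda>x. h / (real q)\<^sup>2 - h / x) \<longlongrightarrow> h / (real q)\<^sup>2 - 0) at_top"
    by (intro tendsto_diff tendsto_const)
  then have "((\<lambda>x. ereal (h / (real q)\<^sup>2 - h / x)) \<longlongrightarrow> ereal ?L) at_top"
    using L by (simp add: tendsto_ereal)
  then have "ereal ?L = Liminf at_top (\<lambda>x. ereal (h / (real q)\<^sup>2 - h / x))"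
    by (metis lim_imp_Liminf trivial_limit_at_top_linorder)
  also have "\<dots> \<le> Liminf at_top (\<lambda>x :: real.
            ereal (real (card {n :: nat. 0 < n \<and> real n \<le> x \<and> even (num_reps 2 q n)}) / x))"
  proof (rule Liminf_mono, rule eventually_mono[OF eventually_gt_at_top[of 0]])
    fix x :: real assume x: "x > 0"
    define N where "N = nat \<lfloor>x / (real q)\<^sup>2\<rfloor>"
    have "x / (real q)\<^sup>2 \<ge> 0" using x by simp
    then have N: "real N \<le> x / (real q)\<^sup>2" "x / (real q)\<^sup>2 \<le> real N + 1"
      unfolding N_def by linarith+
    have "real (q * q * N) \<le> x" using N(1) q by (simp add: field_simps power2_eq_square)
    from card_even_num_reps_ge[OF q this]
    have "real ((q - 1) div 2 * N) \<le> real (card {n. 0 < n \<and> real n \<le> x \<and> even (num_reps 2 q n)})"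
      by (simp only: of_nat_le_iff)
    then have c: "h * real N \<le> real (card {n. 0 < n \<and> real n \<le> x \<and> even (num_reps 2 q n)})"
      using h by simp
    have "h * (x / (real q)\<^sup>2) \<le> h * (real N + 1)" using N(2) h0 by (rule mult_left_mono)
    with c have "h * (x / (real q)\<^sup>2) - h
        \<le> real (card {n. 0 < n \<and> real n \<le> x \<and> even (num_reps 2 q n)})"
      by (simp add: algebra_simps)
    then have "(h * (x / (real q)\<^sup>2) - h) / x
        \<le> real (card {n. 0 < n \<and> real n \<le> x \<and> even (num_reps 2 q n)}) / x"
      using x by (simp add: divide_right_mono)
    moreover have "(h * (x / (real q)\<^sup>2) - h) / x = h / (real q)\<^sup>2 - h / x"
      using x by (simp add: diff_divide_distrib)
    ultimately show "ereal (h / (real q)\<^sup>2 - h / x)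
        \<le> ereal (real (card {n. 0 < n \<and> real n \<le> x \<and> even (num_reps 2 q n)}) / x)"
      by simp
  qed
  finally show ?thesis .
qed

text \<open>Take \<open>k\<close> with \<open>q ^ (k + 1) \<le> x \<le> q ^ (k + 2)\<close>. There
  are at least \<open>h ^ k\<close> odd values, while \<open>x powr s\<close> is at most
  \<open>h ^ (k + 2)\<close> because \<open>q powr s = h\<close>; the quotient is the constant
  \<open>h powr (-2)\<close>.\<close>

lemma odd_num_reps_lower_bound:
  fixes q :: nat
  assumes q: "odd q" "q > 2" and x: "x \<ge> real q"
  shows "((real q - 1) / 2) powr (-2) * x powr (ln ((real q - 1) / 2) / ln (real q))
    \<le> real (card {n :: nat. 0 < n \<and> real n \<le> x \<and> odd (num_reps 2 q n)})"
proof -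
  define h where "h = (real q - 1) / 2"
  define s where "s = ln h / ln (real q)"
  \<comment> \<open>Subtracting 1 leaves room for the factor \<open>q\<close> between
    \<open>m < q ^ k\<close> and \<open>n \<le> q * q ^ k\<close>. The subtraction does not
    truncate, as \<open>x \<ge> real q\<close> makes the logarithm at least 1.\<close>
  define k where "k = nat \<lfloor>log (real q) x\<rfloor> - 1"
  have h: "real ((q - 1) div 2) = h" using q by (auto simp: h_def elim!: oddE)
  have h1: "h \<ge> 1" using q by (simp add: h_def)
  have s0: "s \<ge> 0" using h1 q by (simp add: s_def)
  have q1: "real q > 1" using q by simp
  have x0: "x > 0" using x q by linarith
  have log1: "log (real q) x \<ge> 1" using x q x0 by (simp add: le_log_iff)
  then have k: "real (Suc k) \<le> log (real q) x" "log (real q) x \<le> real (k + 2)"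
    unfolding k_def by linarith+
  have "real q powr real (Suc k) \<le> x" using k(1) q1 x0 by (simp only: le_log_iff)
  then have lo: "real (q * q ^ k) \<le> x" using q1 by (simp add: powr_realpow del: of_nat_Suc)
  have hi: "x \<le> real q powr real (k + 2)" using k(2) q1 x0 by (simp only: log_le_iff)
  have qs: "real q powr s = h" using q1 h1 by (simp add: powr_def s_def)
  have "x powr s \<le> (real q powr real (k + 2)) powr s" using hi s0 x0 by (intro powr_mono2) auto
  also have "\<dots> = h powr real (k + 2)" by (metis qs powr_powr mult.commute)
  finally have "h powr (-2) * x powr s \<le> h powr (-2) * h powr real (k + 2)"
    by (rule mult_left_mono) simp
  also have "\<dots> = h ^ k" using h1 by (simp add: powr_add[symmetric] powr_realpow)
  also have "\<dots> = real (((q - 1) div 2) ^ k)" using h by simp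
  also have "\<dots> \<le> real (parity_count q True (q ^ k))"
    using parity_count_True_power[of q k] q by (intro of_nat_mono) simp
  also have "\<dots> \<le> real (card {n :: nat. 0 < n \<and> real n \<le> x \<and> odd (num_reps 2 q n)})"
    using card_odd_num_reps_ge[OF _ _ lo] q by simp
  finally show ?thesis by (simp add: h_def s_def)
qed

section \<open>Infinitely many odd values for q = 3\<close>

text \<open>Here \<open>(q - 1) div 2 = 1\<close>, so the power bound gives no growth. Instead, a
  largest \<open>k\<close> with an odd value is impossible: the values at \<open>3 * k\<close> and
  \<open>3 * k + 1\<close> differ in parity, so one of them is odd.\<close>

lemma infinite_odd_sum_reps: "infinite {m. odd (sum_reps 3 m)}"
proof
  let ?A = "{m. odd (sum_reps 3 m)}"
  assume fin: "finite ?A"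
  \<comment> \<open>An odd value at a positive argument is needed, since \<open>3 * k\<close> does
    not exceed \<open>k\<close> for \<open>k = 0\<close>; the argument 2, with value 3, provides
    it.\<close>
  have "sum_reps 3 (Suc 0) = 2" using sum_reps_Suc[of 3 0] sum_reps_0[of 3] by simp
  then have "sum_reps 3 (Suc (Suc 0)) = 3"
    using sum_reps_Suc[of 3 "Suc 0"] sum_reps_0[of 3] by simp
  then have two: "Suc (Suc 0) \<in> ?A" by simp
  define k where "k = Max ?A"
  have "k \<in> ?A" unfolding k_def using fin two by (intro Max_in) auto
  moreover have "k \<ge> Suc (Suc 0)" unfolding k_def using fin two by (intro Max_ge) auto
  moreover have "sum_reps 3 (Suc (3 * k + 0)) = sum_reps 3 (3 * k + 0) + sum_reps 3 k"
    by (rule sum_reps_Suc_in_block) auto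
  ultimately have "3 * k \<in> ?A \<or> Suc (3 * k) \<in> ?A" by auto
  then have "3 * k \<le> k \<or> Suc (3 * k) \<le> k" unfolding k_def using fin Max_ge by blast
  with \<open>k \<ge> Suc (Suc 0)\<close> show False by linarith
qed

lemma infinite_odd_num_reps: "infinite {n. 0 < n \<and> odd (num_reps 2 3 n)}"
proof -
  have "infinite ((\<lambda>m. 3 * m + 1) ` {m. odd (sum_reps 3 m)})"
    using infinite_odd_sum_reps by (subst finite_image_iff) (auto intro: inj_onI)
  moreover have "(\<lambda>m. 3 * m + 1) ` {m. odd (sum_reps 3 m)} \<subseteq> {n. 0 < n \<and> odd (num_reps 2 3 n)}"
  proof clarify
    fix m assume "odd (sum_reps 3 m)"
    moreover have "(3 * m + 1) div 3 = m" by simp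
    moreover have "num_reps 2 3 (3 * m + 1) = sum_reps 3 ((3 * m + 1) div 3)"
      by (rule num_reps_eq_sum_reps) auto
    ultimately have "odd (num_reps 2 3 (3 * m + 1))" by metis
    then show "0 < 3 * m + 1 \<and> odd (num_reps 2 3 (3 * m + 1))" by simp
  qed
  ultimately show ?thesis using infinite_super by blast
qed

theorem theorem3:
  fixes q :: nat
  assumes "odd q" and "q > 2"
  shows "Liminf at_top (\<lambda>x :: real.
            ereal (real (card {n :: nat. 0 < n \<and> real n \<le> x \<and> even (num_reps 2 q n)}) / x))
           \<ge> ereal (1 / (2 * real q) - 1 / (2 * (real q)\<^sup>2))
       \<and> (q \<ge> 5 \<longrightarrow>
           (\<exists>c > 0. \<forall>\<^sub>F x :: real in at_top.
              real (card {n :: nat. 0 < n \<and> real n \<le> x \<and> odd (num_reps 2 q n)})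
                \<ge> c * x powr (ln ((real q - 1) / 2) / ln (real q))))
       \<and> infinite {n :: nat. 0 < n \<and> odd (num_reps 2 3 n)}"
proof (intro conjI impI)
  show "Liminf at_top (\<lambda>x :: real.
            ereal (real (card {n :: nat. 0 < n \<and> real n \<le> x \<and> even (num_reps 2 q n)}) / x))
           \<ge> ereal (1 / (2 * real q) - 1 / (2 * (real q)\<^sup>2))"
    using assms by (intro Liminf_even_num_reps_ge) auto
  show "\<exists>c > 0. \<forall>\<^sub>F x :: real in at_top.
              real (card {n :: nat. 0 < n \<and> real n \<le> x \<and> odd (num_reps 2 q n)})
                \<ge> c * x powr (ln ((real q - 1) / 2) / ln (real q))"
  \<comment> \<open>The witness is \<open>h powr (-2)\<close> with \<open>h = (q - 1) / 2\<close>,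
    and the bound holds from \<open>x = q\<close> on.\<close>
  proof (intro exI conjI)
    show "((real q - 1) / 2) powr (-2) > 0" using assms by simp
    show "\<forall>\<^sub>F x :: real in at_top.
              real (card {n :: nat. 0 < n \<and> real n \<le> x \<and> odd (num_reps 2 q n)})
                \<ge> ((real q - 1) / 2) powr (-2) * x powr (ln ((real q - 1) / 2) / ln (real q))"
      using odd_num_reps_lower_bound[OF assms]
      by (rule eventually_mono[OF eventually_ge_at_top[of "real q"]])
  qed
  show "infinite {n :: nat. 0 < n \<and> odd (num_reps 2 3 n)}"
    by (rule infinite_odd_num_reps)
qed

end
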